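(* Let $\mathscr{A}$ be a $C^*$-algebra, and let $\mathrm{Conj}_*(\mathscr{A})$ denote the set of all $*$-conjugate-automorphisms of $\mathscr{A}$. Then the following statements are equivalent. (i) $\mathrm{Conj}_*(\mathscr{A})\neq\varnothing$. (ii) There exists a closed real $*$-subalgebra $\mathscr{A}_{\mathbb{R}}$ of $\mathscr{A}$ such that $\mathscr{A}=\mathscr{A}_{\mathbb{R}}\oplus i\mathscr{A}_{\mathbb{R}}$ as real Banach spaces. (iii) There exists a real $C^*$-algebra $\mathscr{B}$ such that $\mathscr{A}$ is $*$-isomorphic, as a complex $C^*$-algebra, to the complexification $\mathscr{B}_{\mathbb{C}}=\mathscr{B}\otimes_{\mathbb{R}}\mathbb{C}$.
   Context: $C^*$-algebras are complex. A $*$-conjugate-automorphism on a $C^*$-algebra $\mathscr{A}$ is a map $\sharp:\mathscr{A}\to\mathscr{A}$, $a\mapsto a^\sharp$, such that for all $a,b\in\mathscr{A}$, $\lambda\in\mathbb{C}$: (1) $(\lambda a+b)^\sharp=\bar\lambda a^\sharp+b^\sharp$; (2) $(a^\sharp)^\sharp=a$; (3) $(a^\sharp)^*=(a^* )^\sharp$; (4) $(ab)^\sharp=a^\sharp b^\sharp$. A real Banach $*$-algebra $\mathscr{B}$ is a real $C^*$-algebra if there is a norm on its complexification $\mathscr{B}_{\mathbb{C}}$ extending the norm of $\mathscr{B}$ such that $\mathscr{B}_{\mathbb{C}}$ is a complex $C^*$-algebra and $\mathscr{B}$ is a real $*$-subalgebra closed under this norm. The complexification $\mathscr{B}_{\mathbb{C}}=\mathscr{B}\otimes_{\mathbb{R}}\mathbb{C}$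 (with its canonical $C^*$-norm) is algebraically $\mathscr{B}\oplus i\mathscr{B}$ with $(a+ib)(a'+ib')=(aa'-bb')+i(ab'+ba')$ and $(a+ib)^*=a^*-ib^*$. *)

theory Defs
  imports
    "HOL-Analysis.Analysis"
    "HOL-Algebra.AbelCoset"
    "HOL-Algebra.Module"
begin

text \<open>
  Algebras are carrier based, since a real C*-algebra has to be quantified inside a statement and
  the norm of its complexification is part of its definition. The field \<open>one\<close> inherited from the
  ring record is never constrained: algebras need not be unital.
\<close>

record ('k, 'a) normed_star_algebra = "('k, 'a) module" +
  star :: "'a \<Rightarrow> 'a"
  alg_norm :: "'a \<Rightarrow> real"

definition scalar_ring :: "'k :: field ring" where
  "scalar_ring = \<lparr>carrier = UNIV, mult = (*), one = 1, zero = 0, add = (+)\<rparr>"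

text \<open>
  The parameter \<open>cj\<close> is the conjugation of the scalars: \<^const>\<open>cnj\<close> over the complex numbers and the
  identity over the reals.
\<close>

locale star_algebra =
  module "scalar_ring :: ('k :: real_normed_field) ring" A
  for A :: "('k :: real_normed_field, 'a) normed_star_algebra" (structure)
    and cj :: "'k :: real_normed_field \<Rightarrow> 'k" +
  assumes mult_closed: "\<lbrakk>x \<in> carrier A; y \<in> carrier A\<rbrakk> \<Longrightarrow> x \<otimes> y \<in> carrier A"
    and mult_assoc: "\<lbrakk>x \<in> carrier A; y \<in> carrier A; z \<in> carrier A\<rbrakk> \<Longrightarrow> (x \<otimes> y) \<otimes> z = x \<otimes> (y \<otimes> z)"
    and mult_l_distr:
      "\<lbrakk>x \<in> carrier A; y \<in> carrier A; z \<in> carrier A\<rbrakk> \<Longrightarrow> (x \<oplus> y) \<otimes> z = x \<otimes> z \<oplus> y \<otimes> z"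
    and mult_r_distr:
      "\<lbrakk>x \<in> carrier A; y \<in> carrier A; z \<in> carrier A\<rbrakk> \<Longrightarrow> z \<otimes> (x \<oplus> y) = z \<otimes> x \<oplus> z \<otimes> y"
    and smult_mult_left: "\<lbrakk>x \<in> carrier A; y \<in> carrier A\<rbrakk> \<Longrightarrow> (k \<odot> x) \<otimes> y = k \<odot> (x \<otimes> y)"
    and smult_mult_right: "\<lbrakk>x \<in> carrier A; y \<in> carrier A\<rbrakk> \<Longrightarrow> x \<otimes> (k \<odot> y) = k \<odot> (x \<otimes> y)"
    and star_closed: "x \<in> carrier A \<Longrightarrow> star A x \<in> carrier A"
    and star_add: "\<lbrakk>x \<in> carrier A; y \<in> carrier A\<rbrakk> \<Longrightarrow> star A (x \<oplus> y) = star A x \<oplus> star A y"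
    and star_smult: "x \<in> carrier A \<Longrightarrow> star A (k \<odot> x) = cj k \<odot> star A x"
    and star_mult: "\<lbrakk>x \<in> carrier A; y \<in> carrier A\<rbrakk> \<Longrightarrow> star A (x \<otimes> y) = star A y \<otimes> star A x"
    and star_star: "x \<in> carrier A \<Longrightarrow> star A (star A x) = x"

text \<open>
  The conditional makes this a globally nonnegative and symmetric function, as required by the
  locale \<^locale>\<open>Metric_space\<close>.
\<close>

definition alg_dist :: "('k, 'a) normed_star_algebra \<Rightarrow> 'a \<Rightarrow> 'a \<Rightarrow> real" where
  "alg_dist A x y =
    (if x \<in> carrier A \<and> y \<in> carrier A then alg_norm A (x \<ominus>\<^bsub>A\<^esub> y) else 0)"

definition norm_topology :: "('k, 'a) normed_star_algebra \<Rightarrow> 'a topology" where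
  "norm_topology A = Metric_space.mtopology (carrier A) (alg_dist A)"

text \<open>
  The involution of a Banach *-algebra is not required to be isometric. This makes no difference
  for C*-algebras, real or complex, where it is a consequence of the C*-identity.
\<close>

locale banach_star_algebra = star_algebra A cj
  for A :: "('k :: real_normed_field, 'a) normed_star_algebra" (structure)
    and cj :: "'k :: real_normed_field \<Rightarrow> 'k" +
  assumes norm_nonneg: "x \<in> carrier A \<Longrightarrow> 0 \<le> alg_norm A x"
    and norm_eq_zero: "x \<in> carrier A \<Longrightarrow> alg_norm A x = 0 \<longleftrightarrow> x = \<zero>"
    and norm_triangle:
      "\<lbrakk>x \<in> carrier A; y \<in> carrier A\<rbrakk> \<Longrightarrow> alg_norm A (x \<oplus> y) \<le> alg_norm A x + alg_norm A y"
    and norm_smult: "x \<in> carrier A \<Longrightarrow> alg_norm A (k \<odot> x) = norm k * alg_norm A x"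
    and norm_mult:
      "\<lbrakk>x \<in> carrier A; y \<in> carrier A\<rbrakk> \<Longrightarrow> alg_norm A (x \<otimes> y) \<le> alg_norm A x * alg_norm A y"
    and complete: "Metric_space.mcomplete (carrier A) (alg_dist A)"

locale complex_cstar_algebra = banach_star_algebra A cnj
  for A :: "(complex, 'a) normed_star_algebra" (structure) +
  assumes cstar_identity: "x \<in> carrier A \<Longrightarrow> alg_norm A (star A x \<otimes> x) = (alg_norm A x)\<^sup>2"

text \<open>Maps are extensional, i.e. undefined outside of the carrier.\<close>

definition star_conj_automorphisms :: "(complex, 'a) normed_star_algebra \<Rightarrow> ('a \<Rightarrow> 'a) set" where
  "star_conj_automorphisms A =
    {s \<in> carrier A \<rightarrow>\<^sub>E carrier A.
      (\<forall>k. \<forall>a \<in> carrier A. \<forall>b \<in> carrier A.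
        s (k \<odot>\<^bsub>A\<^esub> a \<oplus>\<^bsub>A\<^esub> b) = cnj k \<odot>\<^bsub>A\<^esub> s a \<oplus>\<^bsub>A\<^esub> s b) \<and>
      (\<forall>a \<in> carrier A. s (s a) = a) \<and>
      (\<forall>a \<in> carrier A. star A (s a) = s (star A a)) \<and>
      (\<forall>a \<in> carrier A. \<forall>b \<in> carrier A. s (a \<otimes>\<^bsub>A\<^esub> b) = s a \<otimes>\<^bsub>A\<^esub> s b)}"

definition closed_real_star_subalgebra ::
  "'a set \<Rightarrow> (complex, 'a) normed_star_algebra \<Rightarrow> bool" where
  "closed_real_star_subalgebra X A \<longleftrightarrow>
    additive_subgroup X A \<and>
    (\<forall>r. \<forall>x \<in> X. complex_of_real r \<odot>\<^bsub>A\<^esub> x \<in> X) \<and>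
    (\<forall>x \<in> X. \<forall>y \<in> X. x \<otimes>\<^bsub>A\<^esub> y \<in> X) \<and>
    (\<forall>x \<in> X. star A x \<in> X) \<and>
    closedin (norm_topology A) X"

definition imag_multiples :: "(complex, 'a) normed_star_algebra \<Rightarrow> 'a set \<Rightarrow> 'a set" where
  "imag_multiples A X = (\<lambda>x. \<i> \<odot>\<^bsub>A\<^esub> x) ` X"

text \<open>
  For real subspaces \<open>X\<close> and \<open>Y\<close>: addition is a linear bijection from the product onto \<open>A\<close> with
  bounded inverse. The addition itself is bounded by the triangle inequality.
\<close>

definition is_banach_direct_sum ::
  "(complex, 'a) normed_star_algebra \<Rightarrow> 'a set \<Rightarrow> 'a set \<Rightarrow> bool" where
  "is_banach_direct_sum A X Y \<longleftrightarrow>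
    closedin (norm_topology A) X \<and> closedin (norm_topology A) Y \<and>
    bij_betw (\<lambda>(x, y). x \<oplus>\<^bsub>A\<^esub> y) (X \<times> Y) (carrier A) \<and>
    (\<exists>C. \<forall>x \<in> X. \<forall>y \<in> Y. alg_norm A x + alg_norm A y \<le> C * alg_norm A (x \<oplus>\<^bsub>A\<^esub> y))"

text \<open>The pair \<open>(a, b)\<close> stands for \<open>a + i b\<close>.\<close>

definition complexification_with ::
  "(real, 'b) normed_star_algebra \<Rightarrow> ('b \<times> 'b \<Rightarrow> real) \<Rightarrow> (complex, 'b \<times> 'b) normed_star_algebra"
where
  "complexification_with B N =
    \<lparr>carrier = carrier B \<times> carrier B,
     mult = (\<lambda>(a, b) (a', b').
       (a \<otimes>\<^bsub>B\<^esub> a' \<ominus>\<^bsub>B\<^esub> b \<otimes>\<^bsub>B\<^esub> b', a \<otimes>\<^bsub>B\<^esub> b' \<oplus>\<^bsub>B\<^esub> b \<otimes>\<^bsub>B\<^esub> a')),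
     one = (\<one>\<^bsub>B\<^esub>, \<zero>\<^bsub>B\<^esub>),
     zero = (\<zero>\<^bsub>B\<^esub>, \<zero>\<^bsub>B\<^esub>),
     add = (\<lambda>(a, b) (a', b'). (a \<oplus>\<^bsub>B\<^esub> a', b \<oplus>\<^bsub>B\<^esub> b')),
     smult = (\<lambda>z (a, b).
       (Re z \<odot>\<^bsub>B\<^esub> a \<ominus>\<^bsub>B\<^esub> Im z \<odot>\<^bsub>B\<^esub> b, Re z \<odot>\<^bsub>B\<^esub> b \<oplus>\<^bsub>B\<^esub> Im z \<odot>\<^bsub>B\<^esub> a)),
     star = (\<lambda>(a, b). (star B a, \<ominus>\<^bsub>B\<^esub> star B b)),
     alg_norm = N\<rparr>"

definition is_complexification_norm ::
  "(real, 'b) normed_star_algebra \<Rightarrow> ('b \<times> 'b \<Rightarrow> real) \<Rightarrow> bool" where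
  "is_complexification_norm B N \<longleftrightarrow>
    complex_cstar_algebra (complexification_with B N) \<and>
    (\<forall>a \<in> carrier B. N (a, \<zero>\<^bsub>B\<^esub>) = alg_norm B a) \<and>
    closed_real_star_subalgebra ((\<lambda>a. (a, \<zero>\<^bsub>B\<^esub>)) ` carrier B) (complexification_with B N)"

definition real_cstar_algebra :: "(real, 'b) normed_star_algebra \<Rightarrow> bool" where
  "real_cstar_algebra B \<longleftrightarrow>
    banach_star_algebra B (\<lambda>r. r) \<and> (\<exists>N. is_complexification_norm B N)"

text \<open>
  For a real C*-algebra, the norm chosen here exists by definition; on the carrier it is unique,
  since a *-algebra carries at most one complete C*-norm.
\<close>

definition complexification ::
  "(real, 'b) normed_star_algebra \<Rightarrow> (complex, 'b \<times> 'b) normed_star_algebra" where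
  "complexification B = complexification_with B (SOME N. is_complexification_norm B N)"

definition star_isomorphic ::
  "(complex, 'a) normed_star_algebra \<Rightarrow> (complex, 'b) normed_star_algebra \<Rightarrow> bool" where
  "star_isomorphic A B \<longleftrightarrow>
    (\<exists>\<phi>. bij_betw \<phi> (carrier A) (carrier B) \<and>
      (\<forall>x \<in> carrier A. \<forall>y \<in> carrier A. \<phi> (x \<oplus>\<^bsub>A\<^esub> y) = \<phi> x \<oplus>\<^bsub>B\<^esub> \<phi> y) \<and>
      (\<forall>k. \<forall>x \<in> carrier A. \<phi> (k \<odot>\<^bsub>A\<^esub> x) = k \<odot>\<^bsub>B\<^esub> \<phi> x) \<and>
      (\<forall>x \<in> carrier A. \<forall>y \<in> carrier A. \<phi> (x \<otimes>\<^bsub>A\<^esub> y) = \<phi> x \<otimes>\<^bsub>B\<^esub> \<phi> y) \<and>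
      (\<forall>x \<in> carrier A. \<phi> (star A x) = star B (\<phi> x)))"

end

theory Submission
  imports Defs
begin

text \<open>
  Conjugate automorphisms and decompositions \<open>A = X \<oplus> i X\<close> determine each other by taking fixed
  points and by \<open>x + i y \<mapsto> x - i y\<close>. The only analytic point is that a conjugate automorphism
  \<open>s\<close> is contractive, so that its fixed points form a closed set and the projections are bounded.
  If \<open>h\<close> is self-adjoint with \<open>\<parallel>h\<parallel> < 1\<close>, the contraction \<open>m \<mapsto> (h\<^sup>2 + m\<^sup>2) / 2\<close> has a fixed point
  \<open>m = 1 - sqrt (1 - h\<^sup>2)\<close> that is self-adjoint and commutes with \<open>h\<close>, so \<open>h + i (1 - m)\<close> is unitary.
  This is an algebraic relation between \<open>h\<close> and \<open>m\<close>, hence it also holds for \<open>s h\<close> and \<open>s m\<close>,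
  and \<open>s h\<close>, being the real part of a unitary, has norm at most 1. The C*-identity extends the
  bound from self-adjoint elements to all elements.
\<close>

subsection \<open>Normed star algebras\<close>

lemma scalar_ring_simps [simp]:
  "carrier scalar_ring = UNIV" "mult scalar_ring = (*)" "one scalar_ring = 1"
  "zero scalar_ring = 0" "add scalar_ring = (+)"
  by (simp_all add: scalar_ring_def)

lemma cring_scalar_ring: "cring (scalar_ring :: 'k :: field ring)"
proof (rule cringI)
  show "abelian_group (scalar_ring :: 'k ring)"
    by (rule abelian_groupI) (auto simp: algebra_simps intro: exI [of _ "- x" for x])
  show "comm_monoid (scalar_ring :: 'k ring)"
    by (rule comm_monoidI) (auto simp: algebra_simps)
qed (auto simp: algebra_simps)

section \<open>Algebraic rules of a star algebra\<close>

context star_algebra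
begin

lemma smult_closed' [simp]: "x \<in> carrier A \<Longrightarrow> k \<odot> x \<in> carrier A"
  by (rule smult_closed) simp_all

lemma smult_add_left: "x \<in> carrier A \<Longrightarrow> (k + l) \<odot> x = k \<odot> x \<oplus> l \<odot> x"
  using smult_l_distr [of k l x] by simp

lemma smult_add_right: "\<lbrakk>x \<in> carrier A; y \<in> carrier A\<rbrakk> \<Longrightarrow> k \<odot> (x \<oplus> y) = k \<odot> x \<oplus> k \<odot> y"
  using smult_r_distr [of k x y] by simp

lemma smult_smult: "x \<in> carrier A \<Longrightarrow> k \<odot> (l \<odot> x) = (k * l) \<odot> x"
  using smult_assoc1 [of k l x] by simp

lemma one_smult [simp]: "x \<in> carrier A \<Longrightarrow> 1 \<odot> x = x"
  using smult_one [of x] by simp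

lemma zero_smult [simp]: "x \<in> carrier A \<Longrightarrow> 0 \<odot> x = \<zero>"
  using smult_l_null [of x] by simp

lemma smult_zero [simp]: "k \<odot> \<zero> = \<zero>"
  using smult_r_null [of k] by simp

text \<open>Turning negation into a scalar multiple makes its compatibility with products and
  scalars a consequence of bilinearity.\<close>

lemma a_inv_eq_smult: "x \<in> carrier A \<Longrightarrow> \<ominus> x = (- 1) \<odot> x"
  by (rule M.minus_equality) (use smult_add_left [of x "- 1" 1] in simp_all)

lemma minus_eq_smult: "\<lbrakk>x \<in> carrier A; y \<in> carrier A\<rbrakk> \<Longrightarrow> x \<ominus> y = x \<oplus> (- 1) \<odot> y"
  by (simp add: a_minus_def a_inv_eq_smult)

lemma smult_a_inv: "x \<in> carrier A \<Longrightarrow> k \<odot> (\<ominus> x) = \<ominus> (k \<odot> x)"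
  by (simp add: a_inv_eq_smult smult_smult)

lemma mult_a_inv:
  "\<lbrakk>x \<in> carrier A; y \<in> carrier A\<rbrakk> \<Longrightarrow> x \<otimes> (\<ominus> y) = \<ominus> (x \<otimes> y)"
  "\<lbrakk>x \<in> carrier A; y \<in> carrier A\<rbrakk> \<Longrightarrow> (\<ominus> x) \<otimes> y = \<ominus> (x \<otimes> y)"
  by (simp_all add: a_inv_eq_smult smult_mult_left smult_mult_right mult_closed)

lemma mult_minus_distr:
  "\<lbrakk>x \<in> carrier A; y \<in> carrier A; z \<in> carrier A\<rbrakk> \<Longrightarrow> z \<otimes> (x \<ominus> y) = z \<otimes> x \<ominus> z \<otimes> y"
  "\<lbrakk>x \<in> carrier A; y \<in> carrier A; z \<in> carrier A\<rbrakk> \<Longrightarrow> (x \<ominus> y) \<otimes> z = x \<otimes> z \<ominus> y \<otimes> z"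
  by (simp_all add: a_minus_def mult_a_inv mult_l_distr mult_r_distr)

lemma smult_half_add_self: "x \<in> carrier A \<Longrightarrow> (1 / 2) \<odot> (x \<oplus> x) = x"
  using smult_add_left [of x "1/2" "1/2"] by (simp add: smult_add_right)

lemma minus_add_minus:
  "\<lbrakk>x \<in> carrier A; y \<in> carrier A; z \<in> carrier A\<rbrakk> \<Longrightarrow> (x \<ominus> y) \<oplus> (y \<ominus> z) = x \<ominus> z"
  by (simp add: a_minus_def M.a_assoc M.add.inv_solve_left')

lemma add_minus_add_cancel:
  assumes "x \<in> carrier A" "y \<in> carrier A" "z \<in> carrier A"
  shows "(x \<oplus> y) \<ominus> (x \<oplus> z) = y \<ominus> z"
proof -
  have "(x \<oplus> y) \<ominus> (x \<oplus> z) = (x \<oplus> \<ominus> x) \<oplus> (y \<oplus> \<ominus> z)"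
    using assms unfolding a_minus_def by (simp add: M.minus_add M.a_ac)
  then show ?thesis
    using assms by (simp add: a_minus_def M.r_neg)
qed

lemma uminus_smult: "x \<in> carrier A \<Longrightarrow> (- k) \<odot> x = \<ominus> (k \<odot> x)"
  by (simp add: a_inv_eq_smult smult_smult)

lemma star_zero: "star A \<zero> = \<zero>"
proof -
  have "star A \<zero> \<oplus> star A \<zero> = star A \<zero>"
    by (simp flip: star_add)
  then show ?thesis
    by (simp only: M.add.l_cancel_one star_closed M.zero_closed)
qed

lemma star_a_inv: "x \<in> carrier A \<Longrightarrow> star A (\<ominus> x) = \<ominus> star A x"
  using star_add [of "\<ominus> x" x]
  by (intro M.minus_equality [symmetric]) (simp_all add: star_closed star_zero M.l_neg)

lemma additive_subgroupI2:
  assumes "X \<subseteq> carrier A" "\<zero> \<in> X"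
    and "\<And>x y. \<lbrakk>x \<in> X; y \<in> X\<rbrakk> \<Longrightarrow> x \<oplus> y \<in> X"
    and "\<And>x. x \<in> X \<Longrightarrow> \<ominus> x \<in> X"
  shows "additive_subgroup X A"
proof (rule additive_subgroup.intro, rule subgroup.intro)
qed (use assms in \<open>auto simp flip: a_inv_def\<close>)

end

section \<open>The metric given by the norm\<close>

context banach_star_algebra
begin

lemma norm_a_inv: "x \<in> carrier A \<Longrightarrow> alg_norm A (\<ominus> x) = alg_norm A x"
  by (simp add: a_inv_eq_smult norm_smult)

lemma norm_zero [simp]: "alg_norm A \<zero> = 0"
  by (simp add: norm_eq_zero)

lemma minus_eq_zero_iff: "\<lbrakk>x \<in> carrier A; y \<in> carrier A\<rbrakk> \<Longrightarrow> x \<ominus> y = \<zero> \<longleftrightarrow> x = y"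
  by (metis M.add.inv_solve_right M.add.m_closed M.l_zero M.zero_closed a_minus_def)

lemma norm_minus_le:
  "\<lbrakk>x \<in> carrier A; y \<in> carrier A\<rbrakk> \<Longrightarrow> alg_norm A (x \<ominus> y) \<le> alg_norm A x + alg_norm A y"
  using norm_triangle [of x "\<ominus> y"] by (simp add: a_minus_def norm_a_inv)

lemma Metric_space_alg_dist: "Metric_space (carrier A) (alg_dist A)"
proof
  fix x y z
  show "0 \<le> alg_dist A x y"
    by (simp add: alg_dist_def norm_nonneg)
  show "alg_dist A x y = alg_dist A y x"
    using norm_a_inv [of "x \<ominus> y"]
    by (auto simp: alg_dist_def a_minus_def M.minus_add M.a_comm)
  assume x: "x \<in> carrier A" and y: "y \<in> carrier A"
  then show "alg_dist A x y = 0 \<longleftrightarrow> x = y"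
    by (simp add: alg_dist_def norm_eq_zero minus_eq_zero_iff)
  assume z: "z \<in> carrier A"
  show "alg_dist A x z \<le> alg_dist A x y + alg_dist A y z"
    using norm_triangle [of "x \<ominus> y" "y \<ominus> z"] x y z
    by (simp add: alg_dist_def minus_add_minus)
qed

text \<open>The rewrite makes the facts on metric topologies speak of \<open>norm_topology\<close>,
  the form in which closedness is stated.\<close>

sublocale Metric_space "carrier A" "alg_dist A"
  rewrites "Metric_space.mtopology (carrier A) (alg_dist A) = norm_topology A"
  by (rule Metric_space_alg_dist) (simp add: norm_topology_def)

end

subsection \<open>Real parts of unitaries\<close>

context complex_cstar_algebra
begin

text \<open>The C*-identity and submultiplicativity bound the square of \<open>alg_norm A x\<close>
  by \<open>alg_norm A (star A x) * alg_norm A x\<close>; a nonzero factor cancels.\<close>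

lemma norm_star_le: "x \<in> carrier A \<Longrightarrow> alg_norm A x \<le> alg_norm A (star A x)"
  using cstar_identity [of x] norm_mult [of "star A x" x] star_closed [of x]
    norm_nonneg [of x] norm_nonneg [of "star A x"]
  by (cases "alg_norm A x = 0") (auto simp: power2_eq_square)

lemma norm_star: "x \<in> carrier A \<Longrightarrow> alg_norm A (star A x) = alg_norm A x"
  using norm_star_le [of x] norm_star_le [of "star A x"] by (simp add: star_closed star_star)

lemma star_minus:
  "\<lbrakk>x \<in> carrier A; y \<in> carrier A\<rbrakk> \<Longrightarrow> star A (x \<ominus> y) = star A x \<ominus> star A y"
  by (simp add: a_minus_def star_add star_a_inv star_closed)

text \<open>The hypothesis \<open>pq\<close> says that \<open>star A p \<otimes> q\<close> is
  self-adjoint. The two cross terms in the C*-identity for \<open>p \<oplus> \<i> \<odot> q\<close>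
  are then its multiples by \<i> and -\<i>, and they cancel.\<close>

lemma norm_add_imag_sq:
  assumes p: "p \<in> carrier A" and q: "q \<in> carrier A"
    and pq: "star A p \<otimes> q = star A q \<otimes> p"
  shows "(alg_norm A (p \<oplus> \<i> \<odot> q))\<^sup>2 = alg_norm A (star A p \<otimes> p \<oplus> star A q \<otimes> q)"
proof -
  note [simp] = p q star_closed mult_closed
  have c: "\<i> \<odot> x \<oplus> (- \<i>) \<odot> x = \<zero>" if "x \<in> carrier A" for x
    using smult_add_left [of x "\<i>" "- \<i>"] that by simp
  have "star A (p \<oplus> \<i> \<odot> q) \<otimes> (p \<oplus> \<i> \<odot> q)
      = (star A p \<otimes> p \<oplus> star A q \<otimes> q)
        \<oplus> (\<i> \<odot> (star A p \<otimes> q) \<oplus> (- \<i>) \<odot> (star A p \<otimes> q))"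
    by (simp add: star_add star_smult mult_l_distr mult_r_distr smult_mult_left smult_mult_right
        smult_smult pq [symmetric] M.a_ac smult_add_right)
  then show ?thesis
    using cstar_identity [of "p \<oplus> \<i> \<odot> q"] by (simp add: c)
qed

text \<open>\<open>p\<close> is the mean of \<open>p + i q\<close> and \<open>p - i q\<close>, which both have norm \<open>sqrt \<parallel>p\<^sup>* p + q\<^sup>* q\<parallel>\<close>.\<close>

lemma norm_sq_le_norm_sum_squares:
  assumes p: "p \<in> carrier A" and q: "q \<in> carrier A"
    and pq: "star A p \<otimes> q = star A q \<otimes> p"
  shows "(alg_norm A p)\<^sup>2 \<le> alg_norm A (star A p \<otimes> p \<oplus> star A q \<otimes> q)" (is "_ \<le> ?n")
proof -
  note [simp] = p q star_closed mult_closed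
  have 1: "(alg_norm A (p \<oplus> \<i> \<odot> q))\<^sup>2 = ?n"
    by (rule norm_add_imag_sq [OF p q pq])
  have 2: "(alg_norm A (p \<oplus> \<i> \<odot> (\<ominus> q)))\<^sup>2 = ?n"
    using norm_add_imag_sq [of p "\<ominus> q"] by (simp add: pq star_a_inv mult_a_inv)
  have eq: "alg_norm A (p \<oplus> \<i> \<odot> (\<ominus> q)) = alg_norm A (p \<oplus> \<i> \<odot> q)"
    by (rule power2_eq_imp_eq) (simp_all add: 1 2 norm_nonneg)
  have "(p \<oplus> \<i> \<odot> q) \<oplus> (p \<oplus> \<i> \<odot> (\<ominus> q)) = p \<oplus> p"
    by (simp add: smult_a_inv M.a_ac M.r_neg)
  then have "(1 / 2) \<odot> ((p \<oplus> \<i> \<odot> q) \<oplus> (p \<oplus> \<i> \<odot> (\<ominus> q))) = p"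
    by (simp only: smult_half_add_self p)
  then have "alg_norm A p = alg_norm A ((p \<oplus> \<i> \<odot> q) \<oplus> (p \<oplus> \<i> \<odot> (\<ominus> q))) / 2"
    using norm_smult [of "(p \<oplus> \<i> \<odot> q) \<oplus> (p \<oplus> \<i> \<odot> (\<ominus> q))" "1 / 2"]
    by (simp add: norm_divide)
  also have "\<dots> \<le> alg_norm A (p \<oplus> \<i> \<odot> q)"
    using norm_triangle [of "p \<oplus> \<i> \<odot> q" "p \<oplus> \<i> \<odot> (\<ominus> q)"] eq by simp
  finally show ?thesis
    using 1 by (metis norm_nonneg p power_mono)
qed

text \<open>The relation \<open>h\<^sup>2 + m\<^sup>2 = 2 m\<close> says that \<open>h + i (1 - m)\<close> is unitary, with real part \<open>h\<close>.\<close>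

lemma norm_le_one_if_unitary_part:
  assumes h: "h \<in> carrier A" and m: "m \<in> carrier A"
    and sh: "star A h = h" and sm: "star A m = m" and comm: "h \<otimes> m = m \<otimes> h"
    and sq: "h \<otimes> h \<oplus> m \<otimes> m = m \<oplus> m"
  shows "alg_norm A h \<le> 1"
proof -
  note [simp] = h m star_closed mult_closed
  \<comment> \<open>Here p + i q = (h + i (1 - m)) h: the unitary is multiplied by \<open>h\<close>,
    so that the argument takes place in \<open>A\<close> even without a unit.\<close>
  define p where "p = h \<otimes> h"
  define q where "q = h \<ominus> m \<otimes> h"
  have [simp]: "p \<in> carrier A" "q \<in> carrier A"
    by (simp_all add: p_def q_def)
  have sp: "star A p = h \<otimes> h" and sq': "star A q = h \<ominus> h \<otimes> m"
    by (simp_all add: p_def q_def star_minus star_mult sh sm)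
  have "star A p \<otimes> q = star A q \<otimes> p"
    unfolding sp sq' unfolding p_def q_def
    by (simp add: mult_minus_distr mult_assoc comm) (metis comm h m mult_assoc mult_closed)
  then have "(alg_norm A p)\<^sup>2 \<le> alg_norm A (star A p \<otimes> p \<oplus> star A q \<otimes> q)"
    by (intro norm_sq_le_norm_sum_squares) simp_all
  also have "star A p \<otimes> p \<oplus> star A q \<otimes> q = h \<otimes> h"
  proof -
    \<comment> \<open>The sum expands to h^4 + h m^2 h + h^2 - 2 h m h. The relation
      \<open>sq\<close>, multiplied by \<open>h\<close> from both sides, shows that the first two
      terms cancel against the last.\<close>
    let ?t = "h \<otimes> (m \<otimes> h)"
    have "h \<otimes> ((h \<otimes> h \<oplus> m \<otimes> m) \<otimes> h) = ?t \<oplus> ?t"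
      by (simp add: sq mult_l_distr mult_r_distr)
    then have *: "h \<otimes> (h \<otimes> (h \<otimes> h)) \<oplus> h \<otimes> (m \<otimes> (m \<otimes> h)) = ?t \<oplus> ?t"
      by (simp add: mult_l_distr mult_r_distr mult_assoc)
    have "star A p \<otimes> p \<oplus> star A q \<otimes> q
      = (h \<otimes> (h \<otimes> (h \<otimes> h)) \<oplus> h \<otimes> (m \<otimes> (m \<otimes> h))) \<oplus> (h \<otimes> h \<ominus> ?t \<ominus> ?t)"
      unfolding sp sq' unfolding p_def q_def
      by (simp add: mult_minus_distr mult_assoc) (simp add: a_minus_def M.minus_add M.a_ac)
    also have "\<dots> = h \<otimes> h"
      unfolding * by (simp add: a_minus_def M.a_ac M.r_neg M.add.inv_solve_left' M.minus_add)
    finally show ?thesis .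
  qed
  \<comment> \<open>By the C*-identity the norm of \<open>p\<close> is n =
    \<parallel>h\<parallel>^2, so this reads n^2 \<le> n and forces n \<le> 1.\<close>
  finally have "(alg_norm A p)\<^sup>2 \<le> alg_norm A p"
    by (simp add: p_def)
  moreover have "alg_norm A p = (alg_norm A h)\<^sup>2"
    using cstar_identity [of h] by (simp add: p_def sh)
  ultimately have "(alg_norm A h)\<^sup>2 * (alg_norm A h)\<^sup>2 \<le> (alg_norm A h)\<^sup>2"
    by (simp add: power2_eq_square)
  then have "(alg_norm A h)\<^sup>2 \<le> 1"
    using mult_strict_right_mono [of 1 "(alg_norm A h)\<^sup>2" "(alg_norm A h)\<^sup>2"] by force
  then show ?thesis
    using norm_nonneg [OF h] by (simp add: abs_square_le_1)
qed

text \<open>The Banach fixed point theorem for \<open>F\<close> on a closed ball yields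
  \<open>m\<close>. Self-adjointness and commutation are uniqueness arguments: the defects
  \<open>m \<ominus> star A m\<close> and \<open>h \<otimes> m \<ominus> m \<otimes> h\<close>
  satisfy an equation that a nonzero element cannot satisfy.\<close>

lemma unitary_part_exists:
  assumes h: "h \<in> carrier A" and sh: "star A h = h" and h1: "alg_norm A h < 1"
  obtains m where "m \<in> carrier A" "star A m = m" "h \<otimes> m = m \<otimes> h"
    "h \<otimes> h \<oplus> m \<otimes> m = m \<oplus> m"
proof -
  note [simp] = h star_closed mult_closed
  \<comment> \<open>With this radius \<open>F\<close> maps the ball \<open>?D\<close> into itself
    because r^2 \<le> r, and the same \<open>r\<close> < 1 is a Lipschitz constant of
    \<open>F\<close> on the ball.\<close>
  define r where "r = alg_norm A h"
  define F where "F m = (1 / 2) \<odot> (h \<otimes> h \<oplus> m \<otimes> m)" for m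
  let ?D = "mcball \<zero> r"
  have r: "0 \<le> r" "r < 1"
    using h1 by (simp_all add: r_def norm_nonneg)
  have dist0: "alg_dist A \<zero> x = alg_norm A x" if "x \<in> carrier A" for x
    using that by (simp add: alg_dist_def a_minus_def norm_a_inv)
  have D: "x \<in> ?D \<longleftrightarrow> x \<in> carrier A \<and> alg_norm A x \<le> r" for x
    by (auto simp: in_mcball dist0)
  note [simp del] = in_mcball
  have sq_le: "alg_norm A (x \<otimes> y) \<le> r * alg_norm A y" "alg_norm A (y \<otimes> x) \<le> alg_norm A y * r"
    if "x \<in> ?D" "y \<in> carrier A" for x y
    using that norm_mult [of x y] norm_mult [of y x] norm_nonneg [of y] unfolding D
    by (meson mult_left_mono mult_right_mono order_trans)+
  have half: "alg_norm A ((1 / 2) \<odot> x) = alg_norm A x / 2" if "x \<in> carrier A" for x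
    using that by (simp add: norm_smult norm_divide)
  \<comment> \<open>The difference of two squares is split without commutativity: x^2 - y^2 = x (x -
    y) + (x - y) y.\<close>
  have diff: "F x \<ominus> F y = (1 / 2) \<odot> (x \<otimes> (x \<ominus> y) \<oplus> (x \<ominus> y) \<otimes> y)"
    if "x \<in> carrier A" "y \<in> carrier A" for x y
  proof -
    have "F x \<ominus> F y = (1 / 2) \<odot> ((h \<otimes> h \<oplus> x \<otimes> x) \<ominus> (h \<otimes> h \<oplus> y \<otimes> y))"
      using that by (simp add: F_def a_minus_def smult_add_right smult_a_inv)
    also have "(h \<otimes> h \<oplus> x \<otimes> x) \<ominus> (h \<otimes> h \<oplus> y \<otimes> y) = x \<otimes> x \<ominus> y \<otimes> y"
      using that by (intro add_minus_add_cancel) simp_all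
    also have "\<dots> = x \<otimes> (x \<ominus> y) \<oplus> (x \<ominus> y) \<otimes> y"
      using that by (simp add: mult_minus_distr minus_add_minus)
    finally show ?thesis .
  qed
  \<comment> \<open>The factor \<open>z\<close> stays arbitrary because the estimate is used three
    times: for \<open>x \<ominus> y\<close> in the contraction property, for
    \<open>m \<ominus> star A m\<close>, and for the commutator of \<open>h\<close> and
    \<open>m\<close>.\<close>
  have shrink: "alg_norm A ((1 / 2) \<odot> (x \<otimes> z \<oplus> z \<otimes> y)) \<le> r * alg_norm A z"
    if "x \<in> ?D" "y \<in> ?D" "z \<in> carrier A" for x y z
    using that half [of "x \<otimes> z \<oplus> z \<otimes> y"] norm_triangle [of "x \<otimes> z" "z \<otimes> y"]
      sq_le(1) [of x z] sq_le(2) [of y z]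
    by (auto simp: D mult.commute [of r])
  have null: "z = \<zero>" if "z \<in> carrier A" "alg_norm A z \<le> r * alg_norm A z" for z
    using that r norm_nonneg [of z] norm_eq_zero [of z] mult_less_cancel_right1 [of r "alg_norm A z"]
    by force
  interpret S: Submetric "carrier A" "alg_dist A" ?D
    by unfold_locales (auto simp: D)
  have "S.sub.mcomplete"
    using S.closedin_mcomplete_imp_mcomplete complete closedin_mcball
    by (simp add: norm_topology_def)
  moreover have "?D \<noteq> {}"
    using r by (auto simp: D intro: exI [of _ \<zero>])
  moreover have "F \<in> ?D \<rightarrow> ?D"
  proof
    fix x assume x: "x \<in> ?D"
    have "alg_norm A (F x) \<le> (r * r + r * r) / 2"
      using x sq_le(1) [of x x] sq_le(1) [of h h] norm_triangle [of "h \<otimes> h" "x \<otimes> x"] r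
        half [of "h \<otimes> h \<oplus> x \<otimes> x"] mult_left_mono [of "alg_norm A x" r r]
      by (auto simp: D F_def r_def [symmetric])
    also have "\<dots> \<le> r"
      using r mult_left_mono [of r 1 r] by simp
    finally show "F x \<in> ?D"
      using x by (simp add: D F_def)
  qed
  moreover have "alg_dist A (F x) (F y) \<le> r * alg_dist A x y" if "x \<in> ?D" "y \<in> ?D" for x y
  proof -
    have "F x \<in> carrier A" "F y \<in> carrier A"
      using that by (simp_all add: D F_def)
    then show ?thesis
      using shrink [of x y "x \<ominus> y"] that diff by (simp add: D alg_dist_def)
  qed
  ultimately obtain m where m: "m \<in> ?D" "F m = m"
    using S.sub.Banach_fixedpoint_thm [of F r] r by blast
  then have [simp]: "m \<in> carrier A"
    by (simp add: D)
  \<comment> \<open>Since \<open>h\<close> is self-adjoint, \<open>star A m\<close> is another fixed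
    point of \<open>F\<close> in the ball and must coincide with \<open>m\<close>.\<close>
  have "star A m \<in> ?D"
    using m by (simp add: D norm_star)
  moreover have "F (star A m) = star A m"
  proof -
    have "star A (F m) = F (star A m)"
      by (simp add: F_def star_smult star_add star_mult sh)
    then show ?thesis
      using m by simp
  qed
  ultimately have "alg_norm A (m \<ominus> star A m) \<le> r * alg_norm A (m \<ominus> star A m)"
    using shrink [of m "star A m" "m \<ominus> star A m"] diff [of m "star A m"] m by simp
  then have sm: "star A m = m"
    using null [of "m \<ominus> star A m"] minus_eq_zero_iff [of m "star A m"] by simp
  \<comment> \<open>Taking the commutator with \<open>h\<close> is a derivation that kills h^2.
    Applied to m = (h^2 + m^2) / 2 it gives c = (m c + c m) / 2, so \<open>shrink\<close> and
    \<open>null\<close> force c = 0.\<close>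
  define c where "c = h \<otimes> m \<ominus> m \<otimes> h"
  have [simp]: "c \<in> carrier A" by (simp add: c_def)
  have "c = h \<otimes> F m \<ominus> F m \<otimes> h"
    by (simp add: c_def m)
  also have "\<dots> = (1 / 2) \<odot> (m \<otimes> c \<oplus> c \<otimes> m)"
  proof -
    have "h \<otimes> F m \<ominus> F m \<otimes> h
        = (1 / 2) \<odot> ((h \<otimes> (h \<otimes> h) \<oplus> h \<otimes> (m \<otimes> m)) \<ominus> (h \<otimes> (h \<otimes> h) \<oplus> m \<otimes> (m \<otimes> h)))"
      by (simp add: F_def a_minus_def smult_add_right smult_a_inv smult_mult_left smult_mult_right
          mult_l_distr mult_r_distr mult_assoc)
    also have "(h \<otimes> (h \<otimes> h) \<oplus> h \<otimes> (m \<otimes> m)) \<ominus> (h \<otimes> (h \<otimes> h) \<oplus> m \<otimes> (m \<otimes> h))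
        = h \<otimes> (m \<otimes> m) \<ominus> m \<otimes> (m \<otimes> h)"
      by (intro add_minus_add_cancel) simp_all
    also have "\<dots> = c \<otimes> m \<oplus> m \<otimes> c"
      by (simp add: c_def mult_minus_distr mult_assoc minus_add_minus)
    also have "\<dots> = m \<otimes> c \<oplus> c \<otimes> m"
      by (simp add: M.a_comm)
    finally show ?thesis .
  qed
  finally have "alg_norm A c \<le> r * alg_norm A c"
    using shrink [of m m c] m by simp
  then have "h \<otimes> m = m \<otimes> h"
    using null [of c] by (simp add: c_def minus_eq_zero_iff)
  moreover have "h \<otimes> h \<oplus> m \<otimes> m = m \<oplus> m"
  proof -
    have "m \<oplus> m = F m \<oplus> F m" by (simp add: m)
    also have "\<dots> = h \<otimes> h \<oplus> m \<otimes> m"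
      by (simp add: F_def smult_add_right [symmetric] smult_half_add_self)
    finally show ?thesis ..
  qed
  ultimately show thesis
    by (intro that [of m]) (simp_all add: sm)
qed

end

subsection \<open>Fixed points of a conjugate automorphism\<close>

context banach_star_algebra
begin

text \<open>The complement is open: a fixed point \<open>y\<close> closer to \<open>x\<close> than
  half the distance d from \<open>x\<close> to \<open>f x\<close> would give d \<le> d(x, y) + d(f
  y, f x) < d. The map \<open>f\<close> is arbitrary, so that both \<open>s\<close> and its negative
  are covered.\<close>

lemma closedin_fixed_points:
  assumes f: "\<And>x. x \<in> carrier A \<Longrightarrow> f x \<in> carrier A"
    and contr: "\<And>x y. \<lbrakk>x \<in> carrier A; y \<in> carrier A\<rbrakk> \<Longrightarrow>
      alg_norm A (f x \<ominus> f y) \<le> alg_norm A (x \<ominus> y)"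
  shows "closedin (norm_topology A) {x \<in> carrier A. f x = x}"
proof -
  have "\<exists>r>0. disjnt {x \<in> carrier A. f x = x} (mball x r)" if x: "x \<in> carrier A" "f x \<noteq> x" for x
  proof (intro exI conjI)
    show "0 < alg_dist A x (f x) / 2"
      using x f [of x] by (simp add: mdist_pos_less)
    have "f y \<noteq> y" if y: "y \<in> carrier A" "alg_dist A x y < alg_dist A x (f x) / 2" for y
    proof
      assume "f y = y"
      then have "alg_dist A y (f x) \<le> alg_dist A y x"
        using contr [of y x] x(1) y(1) f [of x] by (simp add: alg_dist_def)
      then show False
        using triangle [of x y "f x"] x y f [of x] commute [of x y] by simp
    qed
    then show "disjnt {x \<in> carrier A. f x = x} (mball x (alg_dist A x (f x) / 2))"
      by (auto simp: disjnt_iff)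
  qed
  then show ?thesis
    using closedin_metric [of "{x \<in> carrier A. f x = x}"] by auto
qed

end

section \<open>Conjugate automorphisms are contractive\<close>

locale conj_automorphism = complex_cstar_algebra +
  fixes s
  assumes s: "s \<in> star_conj_automorphisms A"
begin

lemma s_closed [simp]: "x \<in> carrier A \<Longrightarrow> s x \<in> carrier A"
  using s by (simp add: star_conj_automorphisms_def PiE_iff)

lemma s_s: "x \<in> carrier A \<Longrightarrow> s (s x) = x"
  using s by (simp add: star_conj_automorphisms_def PiE_iff)

lemma s_star: "x \<in> carrier A \<Longrightarrow> s (star A x) = star A (s x)"
  using s by (simp add: star_conj_automorphisms_def PiE_iff)

lemma s_mult: "\<lbrakk>x \<in> carrier A; y \<in> carrier A\<rbrakk> \<Longrightarrow> s (x \<otimes> y) = s x \<otimes> s y"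
  using s by (simp add: star_conj_automorphisms_def PiE_iff)

lemma s_smult_add:
  "\<lbrakk>x \<in> carrier A; y \<in> carrier A\<rbrakk> \<Longrightarrow> s (k \<odot> x \<oplus> y) = cnj k \<odot> s x \<oplus> s y"
  using s by (simp add: star_conj_automorphisms_def PiE_iff)

lemma s_add: "\<lbrakk>x \<in> carrier A; y \<in> carrier A\<rbrakk> \<Longrightarrow> s (x \<oplus> y) = s x \<oplus> s y"
  using s_smult_add [of x y 1] by simp

lemma s_zero [simp]: "s \<zero> = \<zero>"
proof -
  have "s \<zero> \<oplus> s \<zero> = s \<zero>"
    by (simp flip: s_add)
  then show ?thesis
    by (simp only: M.add.l_cancel_one s_closed M.zero_closed)
qed

lemma s_smult: "x \<in> carrier A \<Longrightarrow> s (k \<odot> x) = cnj k \<odot> s x"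
  using s_smult_add [of x \<zero> k] by simp

lemma s_a_inv: "x \<in> carrier A \<Longrightarrow> s (\<ominus> x) = \<ominus> s x"
  by (simp add: a_inv_eq_smult s_smult)

lemma s_minus: "\<lbrakk>x \<in> carrier A; y \<in> carrier A\<rbrakk> \<Longrightarrow> s (x \<ominus> y) = s x \<ominus> s y"
  by (simp add: a_minus_def s_add s_a_inv)

text \<open>The relations between \<open>h\<close> and \<open>m\<close> have real coefficients and
  use only the *-algebra operations, so \<open>s\<close> carries them over to \<open>s h\<close> and
  \<open>s m\<close>.\<close>

lemma norm_s_le_one:
  assumes h: "h \<in> carrier A" "star A h = h" "alg_norm A h < 1"
  shows "alg_norm A (s h) \<le> 1"
proof -
  obtain m where m: "m \<in> carrier A" "star A m = m" "h \<otimes> m = m \<otimes> h"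
      "h \<otimes> h \<oplus> m \<otimes> m = m \<oplus> m"
    by (rule unitary_part_exists [OF h])
  show ?thesis
  proof (rule norm_le_one_if_unitary_part)
    show "star A (s h) = s h" "star A (s m) = s m"
      using h m by (simp_all flip: s_star)
    show "s h \<otimes> s m = s m \<otimes> s h"
      using h m by (simp flip: s_mult)
    have "s (h \<otimes> h \<oplus> m \<otimes> m) = s h \<otimes> s h \<oplus> s m \<otimes> s m" "s (m \<oplus> m) = s m \<oplus> s m"
      using h(1) m(1) by (simp_all add: mult_closed s_mult s_add)
    then show "s h \<otimes> s h \<oplus> s m \<otimes> s m = s m \<oplus> s m"
      by (simp only: m(4))
  qed (use h m in simp_all)
qed

lemma norm_s_self_adjoint_le:
  assumes h: "h \<in> carrier A" "star A h = h"
  shows "alg_norm A (s h) \<le> alg_norm A h"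
proof (rule ccontr)
  let ?a = "alg_norm A h" and ?b = "alg_norm A (s h)"
  assume "\<not> ?b \<le> ?a"
  then have ab: "?a < ?b" "0 \<le> ?a"
    using h by (simp_all add: norm_nonneg)
  \<comment> \<open>The reciprocal of the midpoint of \<open>?a\<close> and \<open>?b\<close>:
    scaling by it puts the norm of \<open>h\<close> below 1 and that of \<open>s h\<close> above
    1.\<close>
  define t where "t = 2 / (?a + ?b)"
  have t: "0 < t" "t * ?a < 1" "1 < t * ?b"
    using ab by (simp_all add: t_def field_simps)
  have "alg_norm A (s (of_real t \<odot> h)) \<le> 1"
    by (rule norm_s_le_one) (use h t in \<open>simp_all add: star_smult norm_smult\<close>)
  then show False
    using t h by (simp add: s_smult norm_smult)
qed

text \<open>The C*-identity reduces the bound to the self-adjoint element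
  \<open>star A x \<otimes> x\<close>, whose image under \<open>s\<close> is
  \<open>star A (s x) \<otimes> s x\<close>.\<close>

lemma norm_s_le:
  assumes x: "x \<in> carrier A"
  shows "alg_norm A (s x) \<le> alg_norm A x"
proof -
  have "(alg_norm A (s x))\<^sup>2 = alg_norm A (s (star A x \<otimes> x))"
    using x by (simp add: s_mult s_star star_closed cstar_identity)
  also have "\<dots> \<le> alg_norm A (star A x \<otimes> x)"
    using x by (intro norm_s_self_adjoint_le) (simp_all add: star_closed mult_closed star_mult star_star)
  also have "\<dots> = (alg_norm A x)\<^sup>2"
    using x by (simp add: cstar_identity)
  finally show ?thesis
    by (rule power2_le_imp_le) (simp add: norm_nonneg x)
qed

definition fixed_points where "fixed_points = {x \<in> carrier A. s x = x}"

lemma closed_real_star_subalgebra_fixed_points: "closed_real_star_subalgebra fixed_points A"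
proof -
  have "closedin (norm_topology A) fixed_points"
    unfolding fixed_points_def
    by (rule closedin_fixed_points) (simp_all add: norm_s_le flip: s_minus)
  moreover have "additive_subgroup fixed_points A"
    by (rule additive_subgroupI2) (auto simp: fixed_points_def s_add s_a_inv)
  ultimately show ?thesis
    by (auto simp: closed_real_star_subalgebra_def fixed_points_def s_smult s_mult s_star
        mult_closed star_closed)
qed

text \<open>Conjugate linearity makes \<i> times the +1 eigenspace of \<open>s\<close> its -1
  eigenspace. In this form the set consists of the fixed points of a contractive map and is seen to
  be closed.\<close>

lemma imag_multiples_fixed_points:
  "imag_multiples A fixed_points = {x \<in> carrier A. \<ominus> s x = x}"
proof (intro equalityI subsetI)
  fix x assume "x \<in> imag_multiples A fixed_points"
  then show "x \<in> {x \<in> carrier A. \<ominus> s x = x}"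
    by (auto simp: imag_multiples_def fixed_points_def s_smult a_inv_eq_smult smult_smult)
next
  fix x assume x: "x \<in> {x \<in> carrier A. \<ominus> s x = x}"
  then have "s x = \<ominus> x"
    using M.minus_minus [of "s x"] by simp
  with x have "(- \<i>) \<odot> x \<in> fixed_points"
    by (simp add: fixed_points_def s_smult a_inv_eq_smult smult_smult)
  moreover have "x = \<i> \<odot> ((- \<i>) \<odot> x)"
    using x by (simp add: smult_smult)
  ultimately show "x \<in> imag_multiples A fixed_points"
    unfolding imag_multiples_def by blast
qed

lemma is_banach_direct_sum_fixed_points:
  "is_banach_direct_sum A fixed_points (imag_multiples A fixed_points)"
proof -
  \<comment> \<open>\<open>P\<close> and \<open>Q\<close> are the projections onto the eigenspaces
    of \<open>s\<close> for 1 and -1. Both are contractive because \<open>s\<close> is, whence the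
    constant 2 for the direct sum.\<close>
  define P where "P a = (1 / 2) \<odot> (a \<oplus> s a)" for a
  define Q where "Q a = (1 / 2) \<odot> (a \<ominus> s a)" for a
  let ?X = fixed_points and ?Y = "imag_multiples A fixed_points"
  have PQ: "P (x \<oplus> y) = x" "Q (x \<oplus> y) = y" if "x \<in> ?X" "y \<in> ?Y" for x y
  proof -
    have xy: "x \<in> carrier A" "y \<in> carrier A" "s x = x" "\<ominus> s y = y"
      using that unfolding imag_multiples_fixed_points by (auto simp: fixed_points_def)
    then have sy: "s y = \<ominus> y"
      using M.minus_minus [of "s y"] by simp
    have "(x \<oplus> y) \<oplus> (x \<oplus> \<ominus> y) = (x \<oplus> x) \<oplus> (y \<oplus> \<ominus> y)"
      "(x \<oplus> y) \<oplus> (\<ominus> x \<oplus> y) = (y \<oplus> y) \<oplus> (x \<oplus> \<ominus> x)"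
      using xy by (simp_all add: M.a_ac)
    then have "(x \<oplus> y) \<oplus> (x \<oplus> \<ominus> y) = x \<oplus> x" "(x \<oplus> y) \<oplus> (\<ominus> x \<oplus> y) = y \<oplus> y"
      using xy by (simp_all add: M.r_neg)
    then show "P (x \<oplus> y) = x" "Q (x \<oplus> y) = y"
      using xy by (simp_all add: P_def Q_def s_add sy a_minus_def M.minus_add smult_half_add_self)
  qed
  have sum: "P a \<in> ?X" "Q a \<in> ?Y" "P a \<oplus> Q a = a" if a: "a \<in> carrier A" for a
  proof -
    show "P a \<in> ?X"
      using a by (simp add: P_def fixed_points_def s_smult s_add s_s M.a_comm)
    show "Q a \<in> ?Y"
      using a by (simp add: Q_def imag_multiples_fixed_points s_smult s_add s_a_inv s_s M.a_comm
          M.minus_add a_minus_def flip: smult_a_inv)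
    have "(a \<oplus> s a) \<oplus> (a \<ominus> s a) = (a \<oplus> a) \<oplus> (s a \<oplus> \<ominus> s a)"
      using a by (simp add: a_minus_def M.a_ac)
    then have "(a \<oplus> s a) \<oplus> (a \<ominus> s a) = a \<oplus> a"
      using a by (simp add: M.r_neg)
    then show "P a \<oplus> Q a = a"
      using a by (simp add: P_def Q_def smult_half_add_self flip: smult_add_right)
  qed
  have half: "alg_norm A ((1 / 2) \<odot> x) = alg_norm A x / 2" if "x \<in> carrier A" for x
    using that by (simp add: norm_smult norm_divide)
  have bound: "alg_norm A (P a) + alg_norm A (Q a) \<le> 2 * alg_norm A a" if a: "a \<in> carrier A" for a
    using a norm_s_le [of a] norm_triangle [of a "s a"] norm_minus_le [of a "s a"]
      half [of "a \<oplus> s a"] half [of "a \<ominus> s a"] by (simp add: P_def Q_def)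
  have carr: "x \<oplus> y \<in> carrier A" if "x \<in> ?X" "y \<in> ?Y" for x y
    using that unfolding imag_multiples_fixed_points by (simp add: fixed_points_def)
  show ?thesis
    unfolding is_banach_direct_sum_def
  proof (intro conjI exI ballI)
    show "closedin (norm_topology A) ?X"
      using closed_real_star_subalgebra_fixed_points by (simp add: closed_real_star_subalgebra_def)
    show "closedin (norm_topology A) ?Y"
      unfolding imag_multiples_fixed_points
    proof (rule closedin_fixed_points)
      fix x y assume xy: "x \<in> carrier A" "y \<in> carrier A"
      have "\<ominus> s x \<ominus> \<ominus> s y = \<ominus> s (x \<ominus> y)"
        using xy by (simp add: a_minus_def s_add s_a_inv M.minus_add)
      then show "alg_norm A (\<ominus> s x \<ominus> \<ominus> s y) \<le> alg_norm A (x \<ominus> y)"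
        using xy by (simp add: norm_a_inv norm_s_le)
    qed simp
    show "bij_betw (\<lambda>(x, y). x \<oplus> y) (?X \<times> ?Y) (carrier A)"
      by (rule bij_betw_byWitness [where f' = "\<lambda>a. (P a, Q a)"]) (auto simp: PQ sum carr)
    show "alg_norm A x + alg_norm A y \<le> 2 * alg_norm A (x \<oplus> y)" if "x \<in> ?X" "y \<in> ?Y" for x y
      using bound [OF carr [OF that]] by (simp add: PQ that)
  qed
qed

end

subsection \<open>Complexifications\<close>

text \<open>The image of a Cauchy sequence converges to a point of the image, which has the form
  \<open>f x\<close>; as distances agree, the sequence itself converges to \<open>x\<close>.\<close>

lemma mcomplete_isometric_preimage:
  assumes "Metric_space M d" "Metric_space (f ` M) d'"
    and iso: "\<And>x y. \<lbrakk>x \<in> M; y \<in> M\<rbrakk> \<Longrightarrow> d' (f x) (f y) = d x y"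
    and compl: "Metric_space.mcomplete (f ` M) d'"
  shows "Metric_space.mcomplete M d"
proof -
  interpret M: Metric_space M d by fact
  interpret M': Metric_space "f ` M" d' by fact
  show ?thesis
    unfolding M.mcomplete_def
  proof (intro allI impI)
    fix \<sigma> assume \<sigma>: "M.MCauchy \<sigma>"
    then have \<sigma>M: "\<sigma> n \<in> M" for n
      by (auto simp: M.MCauchy_def)
    then have "M'.MCauchy (f \<circ> \<sigma>)"
      using \<sigma> by (auto simp: M.MCauchy_def M'.MCauchy_def iso)
    then obtain x where x: "x \<in> M" "limitin M'.mtopology (f \<circ> \<sigma>) (f x) sequentially"
      using compl M'.limitin_mspace unfolding M'.mcomplete_def by blast
    then have "limitin M.mtopology \<sigma> x sequentially"
      by (simp add: M.limitin_metric M'.limitin_metric \<sigma>M iso)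
    then show "\<exists>x. limitin M.mtopology \<sigma> x sequentially" ..
  qed
qed

section \<open>Transfer of Banach *-algebra structure along an embedding\<close>

context banach_star_algebra
begin

text \<open>The axioms are pulled back along the injective map \<open>f\<close>, and completeness is
  inherited from the closed image. The scalar map \<open>g\<close> allows a change of field: the
  inclusion of the reals serves for real subalgebras, the identity for complexifications.\<close>

lemma banach_star_algebra_embedding:
  fixes C :: "('l :: real_normed_field, 'c) normed_star_algebra"
    and f :: "'c \<Rightarrow> 'a" and g :: "'l \<Rightarrow> 'k" and cj' :: "'l \<Rightarrow> 'l"
  assumes closed: "closedin (norm_topology A) (f ` carrier C)"
    and inj: "inj_on f (carrier C)"
    and C_closed:
      "\<zero>\<^bsub>C\<^esub> \<in> carrier C"
      "\<And>x y. \<lbrakk>x \<in> carrier C; y \<in> carrier C\<rbrakk> \<Longrightarrow> x \<oplus>\<^bsub>C\<^esub> y \<in> carrier C"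
      "\<And>x y. \<lbrakk>x \<in> carrier C; y \<in> carrier C\<rbrakk> \<Longrightarrow> x \<otimes>\<^bsub>C\<^esub> y \<in> carrier C"
      "\<And>k x. x \<in> carrier C \<Longrightarrow> k \<odot>\<^bsub>C\<^esub> x \<in> carrier C"
      "\<And>x. x \<in> carrier C \<Longrightarrow> star C x \<in> carrier C"
    and f_hom:
      "f \<zero>\<^bsub>C\<^esub> = \<zero>"
      "\<And>x y. \<lbrakk>x \<in> carrier C; y \<in> carrier C\<rbrakk> \<Longrightarrow> f (x \<oplus>\<^bsub>C\<^esub> y) = f x \<oplus> f y"
      "\<And>x y. \<lbrakk>x \<in> carrier C; y \<in> carrier C\<rbrakk> \<Longrightarrow> f (x \<otimes>\<^bsub>C\<^esub> y) = f x \<otimes> f y"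
      "\<And>k x. x \<in> carrier C \<Longrightarrow> f (k \<odot>\<^bsub>C\<^esub> x) = g k \<odot> f x"
      "\<And>x. x \<in> carrier C \<Longrightarrow> f (star C x) = star A (f x)"
    and norm_C: "\<And>x. x \<in> carrier C \<Longrightarrow> alg_norm C x = alg_norm A (f x)"
    and g: "g 1 = 1" "\<And>k l. g (k + l) = g k + g l" "\<And>k l. g (k * l) = g k * g l"
      "\<And>k. norm (g k) = norm k" "\<And>k. g (cj' k) = cj (g k)"
  shows "banach_star_algebra C cj'"
proof -
  note [simp] = C_closed f_hom norm_C g
  have fA [simp]: "f x \<in> carrier A" if "x \<in> carrier C" for x
    using closedin_subset [OF closed] that by auto
  have f_eq: "x = y" if "f x = f y" "x \<in> carrier C" "y \<in> carrier C" for x y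
    using inj_onD [OF inj that] .
  have g0: "g 0 = 0"
    using g(2) [of 0 0] by simp
  have grp: "abelian_group C"
  proof (rule abelian_groupI)
    show "\<exists>y \<in> carrier C. y \<oplus>\<^bsub>C\<^esub> x = \<zero>\<^bsub>C\<^esub>" if "x \<in> carrier C" for x
    proof (rule bexI)
      \<comment> \<open>The additive inverse in \<open>C\<close> has to be constructed and is taken
        to be the scalar multiple by -1.\<close>
      have "g (- 1) \<odot> f x \<oplus> f x = \<zero>"
        using that smult_add_left [of "f x" "g (- 1)" "g 1"] g(2) [of "- 1" 1] g0 by simp
      then show "(- 1) \<odot>\<^bsub>C\<^esub> x \<oplus>\<^bsub>C\<^esub> x = \<zero>\<^bsub>C\<^esub>"
        using that by (intro f_eq) simp_all
    qed (use that in simp)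
  qed (auto intro!: f_eq simp: M.a_ac)
  have mod: "module (scalar_ring :: 'l ring) C"
    by (rule moduleI [OF cring_scalar_ring grp])
      (auto intro!: f_eq simp: smult_add_left smult_add_right smult_smult)
  have star: "star_algebra C cj'"
    by (intro star_algebra.intro star_algebra_axioms.intro mod)
      (auto intro!: f_eq simp: mult_assoc mult_l_distr mult_r_distr smult_mult_left smult_mult_right
        star_add star_smult star_mult star_star mult_closed star_closed)
  interpret C: star_algebra C cj' by (rule star)
  have f_minus: "f (x \<ominus>\<^bsub>C\<^esub> y) = f x \<ominus> f y" if "x \<in> carrier C" "y \<in> carrier C" for x y
  proof -
    have "g (- 1) = - 1"
      using g(2) [of "- 1" 1] g0 by (simp add: eq_neg_iff_add_eq_0)
    then show ?thesis
      using that by (simp add: minus_eq_smult C.minus_eq_smult)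
  qed
  have dist: "alg_dist A (f x) (f y) = alg_dist C x y" if "x \<in> carrier C" "y \<in> carrier C" for x y
    using that by (simp add: alg_dist_def f_minus)
  have sub: "f ` carrier C \<subseteq> carrier A"
    by auto
  interpret S: Submetric "carrier A" "alg_dist A" "f ` carrier C"
    by unfold_locales (rule sub)
  have metric: "Metric_space (carrier C) (alg_dist C)"
  proof
    fix x y z
    show "0 \<le> alg_dist C x y"
      using dist [of x y] nonneg [of "f x" "f y"] by (auto simp: alg_dist_def)
    show "alg_dist C x y = alg_dist C y x"
      using dist [of x y] dist [of y x] commute [of "f x" "f y"] by (auto simp: alg_dist_def)
    assume x: "x \<in> carrier C" and y: "y \<in> carrier C"
    then show "alg_dist C x y = 0 \<longleftrightarrow> x = y"
      using f_eq by (auto simp flip: dist)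
    assume z: "z \<in> carrier C"
    show "alg_dist C x z \<le> alg_dist C x y + alg_dist C y z"
      using x y z triangle [of "f x" "f y" "f z"] by (simp flip: dist)
  qed
  have "S.sub.mcomplete"
    using S.closedin_mcomplete_imp_mcomplete complete closed by (simp add: norm_topology_def)
  then have compl: "Metric_space.mcomplete (carrier C) (alg_dist C)"
    by (intro mcomplete_isometric_preimage [where f = f and d' = "alg_dist A"] metric dist
        S.sub.Metric_space_axioms)
  show ?thesis
  proof (intro banach_star_algebra.intro star banach_star_algebra_axioms.intro compl)
    fix x assume x: "x \<in> carrier C"
    have "f x = \<zero> \<longleftrightarrow> x = \<zero>\<^bsub>C\<^esub>"
      using x f_eq [of x "\<zero>\<^bsub>C\<^esub>"] by auto
    then show "alg_norm C x = 0 \<longleftrightarrow> x = \<zero>\<^bsub>C\<^esub>"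
      using x by (simp add: norm_eq_zero)
  qed (auto simp: norm_nonneg norm_triangle norm_smult norm_mult)
qed

end

section \<open>The conjugation of a complexification\<close>

lemma complexification_with_simps [simp]:
  "carrier (complexification_with B N) = carrier B \<times> carrier B"
  "(a, b) \<otimes>\<^bsub>complexification_with B N\<^esub> (a', b') =
    (a \<otimes>\<^bsub>B\<^esub> a' \<ominus>\<^bsub>B\<^esub> b \<otimes>\<^bsub>B\<^esub> b', a \<otimes>\<^bsub>B\<^esub> b' \<oplus>\<^bsub>B\<^esub> b \<otimes>\<^bsub>B\<^esub> a')"
  "(a, b) \<oplus>\<^bsub>complexification_with B N\<^esub> (a', b') = (a \<oplus>\<^bsub>B\<^esub> a', b \<oplus>\<^bsub>B\<^esub> b')"
  "\<zero>\<^bsub>complexification_with B N\<^esub> = (\<zero>\<^bsub>B\<^esub>, \<zero>\<^bsub>B\<^esub>)"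
  "z \<odot>\<^bsub>complexification_with B N\<^esub> (a, b) =
    (Re z \<odot>\<^bsub>B\<^esub> a \<ominus>\<^bsub>B\<^esub> Im z \<odot>\<^bsub>B\<^esub> b, Re z \<odot>\<^bsub>B\<^esub> b \<oplus>\<^bsub>B\<^esub> Im z \<odot>\<^bsub>B\<^esub> a)"
  "star (complexification_with B N) (a, b) = (star B a, \<ominus>\<^bsub>B\<^esub> star B b)"
  "alg_norm (complexification_with B N) = N"
  by (simp_all add: complexification_with_def)

text \<open>The map a + i b \<mapsto> a - i b, restricted to the carrier because conjugate
  automorphisms are extensional.\<close>

definition complexification_conj ::
  "(real, 'b) normed_star_algebra \<Rightarrow> 'b \<times> 'b \<Rightarrow> 'b \<times> 'b" where
  "complexification_conj B = (\<lambda>p \<in> carrier B \<times> carrier B. (fst p, \<ominus>\<^bsub>B\<^esub> snd p))"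

text \<open>No norm enters the laws, so \<open>N\<close> is arbitrary; this makes the lemma
  applicable to the norm picked by \<open>SOME\<close> in \<open>complexification\<close>.\<close>

lemma complexification_conj_in_star_conj_automorphisms:
  assumes "star_algebra B (\<lambda>r. r)"
  shows "complexification_conj B \<in> star_conj_automorphisms (complexification_with B N)"
proof -
  interpret star_algebra B "\<lambda>r. r" by fact
  note [simp] = mult_closed star_closed
  have "complexification_conj B \<in> carrier B \<times> carrier B \<rightarrow>\<^sub>E carrier B \<times> carrier B"
    by (auto simp: complexification_conj_def)
  then show ?thesis
    unfolding star_conj_automorphisms_def
    by (auto simp: complexification_conj_def uminus_smult smult_a_inv mult_a_inv star_a_inv
        a_minus_def M.minus_add M.a_ac)
qed

text \<open>The copy of \<open>B\<close> is the set of fixed points of the conjugation, so its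
  closedness comes from the contractivity of conjugate automorphisms.\<close>

lemma closed_real_star_subalgebra_complexification:
  assumes "star_algebra B (\<lambda>r. r)" and "complex_cstar_algebra (complexification_with B N)"
  shows "closed_real_star_subalgebra ((\<lambda>a. (a, \<zero>\<^bsub>B\<^esub>)) ` carrier B) (complexification_with B N)"
proof -
  interpret B: star_algebra B "\<lambda>r. r" by fact
  interpret C: complex_cstar_algebra "complexification_with B N" by fact
  interpret conj_automorphism "complexification_with B N" "complexification_conj B"
    by unfold_locales (rule complexification_conj_in_star_conj_automorphisms [OF assms(1)])
  have "b = \<zero>\<^bsub>B\<^esub>" if "b \<in> carrier B" "\<ominus>\<^bsub>B\<^esub> b = b" for b
    using B.smult_half_add_self [of b] B.M.r_neg [of b] that by simp
  then have "(\<lambda>a. (a, \<zero>\<^bsub>B\<^esub>)) ` carrier B = fixed_points"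
    unfolding fixed_points_def by (auto simp: complexification_conj_def)
  then show ?thesis
    using closed_real_star_subalgebra_fixed_points by simp
qed

text \<open>The map \<open>t\<close> is conjugated by the isomorphism \<open>\<phi>\<close>. Each
  law for the result is checked after applying \<open>\<phi>\<close>, which is injective.\<close>

lemma star_conj_automorphisms_star_isomorphic:
  assumes "star_algebra A cnj" and iso: "star_isomorphic A C" and t: "t \<in> star_conj_automorphisms C"
  shows "star_conj_automorphisms A \<noteq> {}"
proof -
  interpret star_algebra A cnj by fact
  note [simp] = mult_closed star_closed
  obtain \<phi> where "bij_betw \<phi> (carrier A) (carrier C) \<and>
      (\<forall>x \<in> carrier A. \<forall>y \<in> carrier A. \<phi> (x \<oplus>\<^bsub>A\<^esub> y) = \<phi> x \<oplus>\<^bsub>C\<^esub> \<phi> y) \<and>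
      (\<forall>k. \<forall>x \<in> carrier A. \<phi> (k \<odot>\<^bsub>A\<^esub> x) = k \<odot>\<^bsub>C\<^esub> \<phi> x) \<and>
      (\<forall>x \<in> carrier A. \<forall>y \<in> carrier A. \<phi> (x \<otimes>\<^bsub>A\<^esub> y) = \<phi> x \<otimes>\<^bsub>C\<^esub> \<phi> y) \<and>
      (\<forall>x \<in> carrier A. \<phi> (star A x) = star C (\<phi> x))"
    using iso unfolding star_isomorphic_def by (rule exE)
  then have bij: "bij_betw \<phi> (carrier A) (carrier C)"
    and \<phi> [simp]:
      "\<And>x y. \<lbrakk>x \<in> carrier A; y \<in> carrier A\<rbrakk> \<Longrightarrow> \<phi> (x \<oplus>\<^bsub>A\<^esub> y) = \<phi> x \<oplus>\<^bsub>C\<^esub> \<phi> y"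
      "\<And>k x. x \<in> carrier A \<Longrightarrow> \<phi> (k \<odot>\<^bsub>A\<^esub> x) = k \<odot>\<^bsub>C\<^esub> \<phi> x"
      "\<And>x y. \<lbrakk>x \<in> carrier A; y \<in> carrier A\<rbrakk> \<Longrightarrow> \<phi> (x \<otimes>\<^bsub>A\<^esub> y) = \<phi> x \<otimes>\<^bsub>C\<^esub> \<phi> y"
      "\<And>x. x \<in> carrier A \<Longrightarrow> \<phi> (star A x) = star C (\<phi> x)"
    by simp_all
  have \<phi>C [simp]: "\<phi> x \<in> carrier C" if "x \<in> carrier A" for x
    using bij_betwE [OF bij] that by blast
  have t' [simp]:
    "\<And>x. x \<in> carrier C \<Longrightarrow> t x \<in> carrier C"
    "\<And>x. x \<in> carrier C \<Longrightarrow> t (t x) = x"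
    "\<And>x. x \<in> carrier C \<Longrightarrow> t (star C x) = star C (t x)"
    "\<And>x y. \<lbrakk>x \<in> carrier C; y \<in> carrier C\<rbrakk> \<Longrightarrow> t (x \<otimes>\<^bsub>C\<^esub> y) = t x \<otimes>\<^bsub>C\<^esub> t y"
    "\<And>k x y. \<lbrakk>x \<in> carrier C; y \<in> carrier C\<rbrakk> \<Longrightarrow>
      t (k \<odot>\<^bsub>C\<^esub> x \<oplus>\<^bsub>C\<^esub> y) = cnj k \<odot>\<^bsub>C\<^esub> t x \<oplus>\<^bsub>C\<^esub> t y"
    using t by (simp_all add: star_conj_automorphisms_def PiE_iff)
  define s where "s = (\<lambda>x \<in> carrier A. inv_into (carrier A) \<phi> (t (\<phi> x)))"
  have s [simp]: "s x \<in> carrier A" "\<phi> (s x) = t (\<phi> x)" if "x \<in> carrier A" for x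
    using that bij by (simp_all add: s_def bij_betw_def inv_into_into f_inv_into_f)
  have eq: "x = y" if "\<phi> x = \<phi> y" "x \<in> carrier A" "y \<in> carrier A" for x y
    using bij_betw_imp_inj_on [OF bij] that by (rule inj_onD)
  have "s \<in> carrier A \<rightarrow>\<^sub>E carrier A"
    using s(1) by (auto simp: s_def)
  then have "s \<in> star_conj_automorphisms A"
    unfolding star_conj_automorphisms_def
    by (intro CollectI conjI allI ballI) (assumption | rule eq, simp_all)+
  then show ?thesis
    by blast
qed

section \<open>From a real form to a real C*-algebra\<close>

locale real_form = complex_cstar_algebra +
  fixes X
  assumes X: "closed_real_star_subalgebra X A" "is_banach_direct_sum A X (imag_multiples A X)"
begin

text \<open>The elements keep their type, so the witness for statement (iii) lives on the type of
  \<open>A\<close>.\<close>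

definition B where
  "B = \<lparr>carrier = X, mult = mult A, one = one A, zero = zero A, add = add A,
     smult = (\<lambda>r. smult A (complex_of_real r)), star = star A, alg_norm = alg_norm A\<rparr>"

lemma B_simps [simp]:
  "carrier B = X" "mult B = mult A" "zero B = zero A" "add B = add A"
  "smult B = (\<lambda>r. smult A (complex_of_real r))" "star B = star A" "alg_norm B = alg_norm A"
  by (simp_all add: B_def)

lemma X_carrier [simp]: "x \<in> X \<Longrightarrow> x \<in> carrier A"
  using additive_subgroup.a_subset [of X A] X(1) by (auto simp: closed_real_star_subalgebra_def)

lemma X_closed [simp]:
  "\<zero> \<in> X"
  "\<lbrakk>x \<in> X; y \<in> X\<rbrakk> \<Longrightarrow> x \<oplus> y \<in> X"
  "\<lbrakk>x \<in> X; y \<in> X\<rbrakk> \<Longrightarrow> x \<otimes> y \<in> X"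
  "x \<in> X \<Longrightarrow> complex_of_real r \<odot> x \<in> X"
  "x \<in> X \<Longrightarrow> star A x \<in> X"
  using additive_subgroup.zero_closed [of X A] additive_subgroup.a_closed [of X A x y] X(1)
  by (auto simp: closed_real_star_subalgebra_def)

lemma banach_star_algebra_B: "banach_star_algebra B (\<lambda>r. r)"
  by (rule banach_star_algebra_embedding [where f = "\<lambda>x. x" and g = complex_of_real])
    (use X(1) in \<open>auto simp: closed_real_star_subalgebra_def\<close>)

sublocale B: banach_star_algebra B "\<lambda>r. r"
  by (rule banach_star_algebra_B)

text \<open>Negation refers to the carrier and so is not literally the same in \<open>B\<close> and
  \<open>A\<close>; both agree with the scalar multiple by -1.\<close>

lemma a_inv_B: "x \<in> X \<Longrightarrow> \<ominus>\<^bsub>B\<^esub> x = \<ominus> x"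
  using B.a_inv_eq_smult [of x] by (simp add: a_inv_eq_smult)

lemma minus_B: "\<lbrakk>x \<in> X; y \<in> X\<rbrakk> \<Longrightarrow> x \<ominus>\<^bsub>B\<^esub> y = x \<ominus> y"
  by (simp add: a_minus_def a_inv_B)

lemma X_a_inv [simp]: "x \<in> X \<Longrightarrow> \<ominus> x \<in> X"
  using B.M.a_inv_closed [of x] by (simp add: a_inv_B)

lemma X_minus [simp]: "\<lbrakk>x \<in> X; y \<in> X\<rbrakk> \<Longrightarrow> x \<ominus> y \<in> X"
  by (simp add: a_minus_def)

text \<open>The inverse of \<open>\<Psi>\<close> will be the *-isomorphism onto the
  complexification.\<close>

definition \<Psi> where "\<Psi> = (\<lambda>(a, b). a \<oplus> \<i> \<odot> b)"

lemma bij_\<Psi>: "bij_betw \<Psi> (X \<times> X) (carrier A)"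
proof -
  have "inj_on (\<lambda>x. \<i> \<odot> x) X"
    by (rule inj_on_inverseI [where g = "\<lambda>x. (- \<i>) \<odot> x"]) (simp add: smult_smult)
  then have "bij_betw (map_prod id (\<lambda>x. \<i> \<odot> x)) (X \<times> X) (X \<times> imag_multiples A X)"
    unfolding imag_multiples_def
    by (intro bij_betw_map_prod bij_betw_id inj_on_imp_bij_betw)
  then have "bij_betw ((\<lambda>(x, y). x \<oplus> y) \<circ> map_prod id (\<lambda>x. \<i> \<odot> x)) (X \<times> X) (carrier A)"
    by (rule bij_betw_trans) (use X(2) in \<open>simp add: is_banach_direct_sum_def\<close>)
  also have "(\<lambda>(x, y). x \<oplus> y) \<circ> map_prod id (\<lambda>x. \<i> \<odot> x) = \<Psi>"
    by (auto simp: \<Psi>_def)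
  finally show ?thesis .
qed

text \<open>The norm \<open>N\<close> is left open, since the laws are needed both for the norm
  pulled back along \<open>\<Psi>\<close> and for the norm selected in
  \<open>complexification\<close>.\<close>

lemma \<Psi>_hom:
  fixes N
  defines "C \<equiv> complexification_with B N"
  shows "p \<in> X \<times> X \<Longrightarrow> \<Psi> p \<in> carrier A"
    and "\<Psi> \<zero>\<^bsub>C\<^esub> = \<zero>"
    and "\<lbrakk>p \<in> X \<times> X; q \<in> X \<times> X\<rbrakk> \<Longrightarrow> \<Psi> (p \<oplus>\<^bsub>C\<^esub> q) = \<Psi> p \<oplus> \<Psi> q"
    and "\<lbrakk>p \<in> X \<times> X; q \<in> X \<times> X\<rbrakk> \<Longrightarrow> \<Psi> (p \<otimes>\<^bsub>C\<^esub> q) = \<Psi> p \<otimes> \<Psi> q"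
    and "p \<in> X \<times> X \<Longrightarrow> \<Psi> (k \<odot>\<^bsub>C\<^esub> p) = k \<odot> \<Psi> p"
    and "p \<in> X \<times> X \<Longrightarrow> \<Psi> (star C p) = star A (\<Psi> p)"
proof -
  note [simp] = mult_closed star_closed
  show "p \<in> X \<times> X \<Longrightarrow> \<Psi> p \<in> carrier A"
    by (auto simp: \<Psi>_def)
  show "\<Psi> \<zero>\<^bsub>C\<^esub> = \<zero>"
    by (simp add: \<Psi>_def C_def)
  show "\<Psi> (p \<oplus>\<^bsub>C\<^esub> q) = \<Psi> p \<oplus> \<Psi> q" if "p \<in> X \<times> X" "q \<in> X \<times> X"
    using that by (auto simp: \<Psi>_def C_def smult_add_right M.a_ac)
  show "\<Psi> (p \<otimes>\<^bsub>C\<^esub> q) = \<Psi> p \<otimes> \<Psi> q" if "p \<in> X \<times> X" "q \<in> X \<times> X"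
    using that by (auto simp: \<Psi>_def C_def minus_B minus_eq_smult smult_add_right smult_mult_left
        smult_mult_right smult_smult mult_l_distr mult_r_distr M.a_ac)
  show "\<Psi> (k \<odot>\<^bsub>C\<^esub> p) = k \<odot> \<Psi> p" if p: "p \<in> X \<times> X"
  proof -
    obtain a b where ab: "p = (a, b)" "a \<in> X" "b \<in> X" using p by auto
    \<comment> \<open>Scalars are split into real and imaginary parts because the action on pairs is
      defined through them.\<close>
    have "k \<odot> x = complex_of_real (Re k) \<odot> x \<oplus> (\<i> * complex_of_real (Im k)) \<odot> x"
      if "x \<in> X" for x
      using smult_add_left [of x "complex_of_real (Re k)" "\<i> * complex_of_real (Im k)"] that
      by (simp flip: complex_eq)
    moreover have "(l - m) \<odot> x = l \<odot> x \<oplus> (- m) \<odot> x" if "x \<in> X" for l m x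
      using smult_add_left [of x l "- m"] that by simp
    moreover have "k * \<i> = - complex_of_real (Im k) + \<i> * complex_of_real (Re k)"
      by (simp add: complex_eq_iff)
    ultimately show ?thesis
      using ab by (simp add: \<Psi>_def C_def minus_B minus_eq_smult smult_add_right smult_smult
          smult_add_left M.a_ac)
  qed
  show "\<Psi> (star C p) = star A (\<Psi> p)" if "p \<in> X \<times> X"
    using that by (auto simp: \<Psi>_def C_def a_inv_B star_add star_smult a_inv_eq_smult smult_smult)
qed

lemma complexification_closed:
  fixes N
  defines "C \<equiv> complexification_with B N"
  shows "\<lbrakk>p \<in> X \<times> X; q \<in> X \<times> X\<rbrakk> \<Longrightarrow> p \<oplus>\<^bsub>C\<^esub> q \<in> X \<times> X"
    and "\<lbrakk>p \<in> X \<times> X; q \<in> X \<times> X\<rbrakk> \<Longrightarrow> p \<otimes>\<^bsub>C\<^esub> q \<in> X \<times> X"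
    and "p \<in> X \<times> X \<Longrightarrow> k \<odot>\<^bsub>C\<^esub> p \<in> X \<times> X"
    and "p \<in> X \<times> X \<Longrightarrow> star C p \<in> X \<times> X"
  by (auto simp: C_def minus_B a_inv_B)

text \<open>The norm is pulled back along the bijection \<open>\<Psi>\<close>. Its image is all of
  \<open>A\<close>, hence closed, and the C*-identity is transported.\<close>

lemma complex_cstar_algebra_complexification:
  "complex_cstar_algebra (complexification_with B (\<lambda>p. alg_norm A (\<Psi> p)))"
  (is "complex_cstar_algebra ?C")
proof -
  have "closedin (norm_topology A) (\<Psi> ` carrier ?C)"
    using bij_betw_imp_surj_on [OF bij_\<Psi>] closedin_topspace [of "norm_topology A"] by simp
  \<comment> \<open>The operations on pairs stay folded so that \<open>\<Psi>_hom\<close> can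
    rewrite them. Zero is still unfolded, which is why its law enters in simplified form.\<close>
  then have "banach_star_algebra ?C cnj"
    by (rule banach_star_algebra_embedding [where g = "\<lambda>k. k"])
      (use bij_betw_imp_inj_on [OF bij_\<Psi>] in
        \<open>auto simp: \<Psi>_hom \<Psi>_hom(2) [simplified] complexification_closed
          simp del: complexification_with_simps(2,3,5,6)\<close>)
  then show ?thesis
    by (intro complex_cstar_algebra.intro complex_cstar_algebra_axioms.intro)
      (simp_all add: \<Psi>_hom complexification_closed cstar_identity
        del: complexification_with_simps(2,3,5,6) split_paired_All)
qed

lemma is_complexification_norm_B: "is_complexification_norm B (\<lambda>p. alg_norm A (\<Psi> p))"
  unfolding is_complexification_norm_def
  using complex_cstar_algebra_complexification
    closed_real_star_subalgebra_complexification [OF B.star_algebra_axioms]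
  by (simp add: \<Psi>_def)

lemma real_cstar_algebra_B: "real_cstar_algebra B"
  unfolding real_cstar_algebra_def
  using banach_star_algebra_B is_complexification_norm_B by blast

lemma star_isomorphic_complexification: "star_isomorphic A (complexification B)"
proof -
  define C where "C = complexification B"
  \<comment> \<open>Any \<open>N\<close> will do here, since \<open>star_isomorphic\<close> concerns
    the algebraic operations only.\<close>
  obtain N where C: "C = complexification_with B N"
    by (simp add: C_def complexification_def)
  note hom = \<Psi>_hom(2-) [where N = N, folded C]
  note closed = complexification_closed [where N = N, folded C]
  have carr: "carrier C = X \<times> X"
    by (simp add: C)
  let ?\<phi> = "inv_into (X \<times> X) \<Psi>"
  have \<phi>: "?\<phi> x \<in> X \<times> X" "\<Psi> (?\<phi> x) = x" if "x \<in> carrier A" for x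
    using bij_\<Psi> that by (simp_all add: bij_betw_def inv_into_into f_inv_into_f del: mem_Times_iff)
  \<comment> \<open>This reduces each law for \<open>?\<phi>\<close> to the corresponding law for
    \<open>\<Psi>\<close>.\<close>
  have eq: "?\<phi> x = p" if "p \<in> X \<times> X" "\<Psi> p = x" for x p
    using bij_\<Psi> that by (auto simp: bij_betw_def)
  show ?thesis
    unfolding star_isomorphic_def C_def [symmetric]
  proof (intro exI conjI ballI allI)
    show "bij_betw ?\<phi> (carrier A) (carrier C)"
      using bij_betw_inv_into [OF bij_\<Psi>] by (simp add: carr)
  qed (rule eq; simp only: hom closed \<Psi>_hom(1) \<phi>)+
qed

end

text \<open>The conjugation of the complexification is transported to \<open>A\<close>. The element
  type of \<open>B\<close> is free.\<close>

lemma star_conj_automorphisms_if_star_isomorphic_complexification: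
  assumes "complex_cstar_algebra A" and "real_cstar_algebra B"
    and iso: "star_isomorphic A (complexification B)"
  shows "star_conj_automorphisms A \<noteq> {}"
proof -
  interpret A: complex_cstar_algebra A by fact
  have "star_algebra B (\<lambda>r. r)"
    using assms(2) by (simp add: real_cstar_algebra_def banach_star_algebra_def)
  then have "complexification_conj B \<in> star_conj_automorphisms (complexification B)"
    unfolding complexification_def by (rule complexification_conj_in_star_conj_automorphisms)
  then show ?thesis
    by (rule star_conj_automorphisms_star_isomorphic [OF A.star_algebra_axioms iso])
qed

text \<open>A formula cannot quantify over the element type of the real algebra in (iii). The
  equivalence is therefore stated with the type \<open>'a\<close>, where a witness can be found, and
  the implication from (iii) to (i) also with an arbitrary type \<open>'b\<close>.\<close>

theorem theorem2p4:
  fixes A :: "(complex, 'a) normed_star_algebra"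
  assumes "complex_cstar_algebra A"
  shows "(star_conj_automorphisms A \<noteq> {} \<longleftrightarrow>
            (\<exists>X. closed_real_star_subalgebra X A \<and> is_banach_direct_sum A X (imag_multiples A X)))
       \<and> (star_conj_automorphisms A \<noteq> {} \<longleftrightarrow>
            (\<exists>B :: (real, 'a) normed_star_algebra.
               real_cstar_algebra B \<and> star_isomorphic A (complexification B)))
       \<and> ((\<exists>B :: (real, 'b) normed_star_algebra.
               real_cstar_algebra B \<and> star_isomorphic A (complexification B))
            \<longrightarrow> star_conj_automorphisms A \<noteq> {})"
proof -
  interpret A: complex_cstar_algebra A by fact
  let ?ii = "\<exists>X. closed_real_star_subalgebra X A \<and> is_banach_direct_sum A X (imag_multiples A X)"
  let ?iii = "\<exists>B :: (real, 'a) normed_star_algebra.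
    real_cstar_algebra B \<and> star_isomorphic A (complexification B)"
  have i_ii: "?ii" if i: "star_conj_automorphisms A \<noteq> {}"
  proof -
    obtain s where "s \<in> star_conj_automorphisms A"
      using i by blast
    then interpret conj_automorphism A s
      by unfold_locales
    show ?thesis
      using closed_real_star_subalgebra_fixed_points is_banach_direct_sum_fixed_points by blast
  qed
  have ii_iii: "?iii" if ii: "?ii"
  proof -
    obtain X where "closed_real_star_subalgebra X A" "is_banach_direct_sum A X (imag_multiples A X)"
      using ii by blast
    then interpret real_form A X
      by unfold_locales
    show ?thesis
      using real_cstar_algebra_B star_isomorphic_complexification by blast
  qed
  \<comment> \<open>The type of \<open>B\<close> remains schematic in this fact, which is used at
    both \<open>'a\<close> and \<open>'b\<close>.\<close>
  note iii_i = star_conj_automorphisms_if_star_isomorphic_complexification [OF assms]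
  have "star_conj_automorphisms A \<noteq> {} \<longleftrightarrow> ?ii" "star_conj_automorphisms A \<noteq> {} \<longleftrightarrow> ?iii"
    using i_ii ii_iii iii_i by blast+
  then show ?thesis
    using iii_i by blast
qed

end
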